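(* If $a_1 \pmod{q_1}, \ldots, a_k \pmod{q_k}$ is a collection of pairwise disjoint arithmetic progressions, where the moduli $q_i$ are square-free integers with $2 \leq q_1 < q_2 < \cdots < q_k \leq x$, then $$k < \frac{x}{L(1/2 - o(1), x)}.$$
   Context: For real $c$ and large $x$, $L(c,x) := \exp\left(c\sqrt{\log x \log\log x}\right)$. The arithmetic progression $a \pmod{q}$ is the residue class $\{n \in \mathbb{Z} : n \equiv a \pmod q\}$. A collection of progressions is called disjoint (non-intersecting) if $\{a_i \pmod{q_i}\} \cap \{a_j \pmod{q_j}\} = \emptyset$ whenever $i \neq j$. The term $o(1)$ denotes a quantity tending to $0$ as $x \to \infty$, depending only on $x$ (i.e., uniform over all such collections). *)

theory Defs
  imports Complex_Main "HOL-Number_Theory.Cong" "HOL-Computational_Algebra.Squarefree"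
    "HOL-Library.Disjoint_Sets"
begin

(* Intended for x >= exp 1, where ln (ln x) >= 0. *)
definition L :: "real \<Rightarrow> real \<Rightarrow> real" where
  "L c x = exp (c * sqrt (ln x * ln (ln x)))"

definition arith_prog :: "int \<Rightarrow> int \<Rightarrow> int set" where
  "arith_prog a q = {n. [n = a] (mod q)}"

end

theory Submission
  imports Defs "HOL-Analysis.Harmonic_Numbers" "HOL-Real_Asymp.Real_Asymp"
begin

text \<open>
  Put \<open>R = sqrt (ln x / ln (ln x))\<close> and \<open>y = L(1 - o(1), x)\<close>, chosen so that \<open>y powr R = x / L(1/2, x)\<close>.
  At most \<open>x / L(1/2 - o(1), x)\<close> squarefree integers up to \<open>x\<close> have more than \<open>R\<close> prime factors. A
  modulus with at most \<open>R\<close> prime factors that exceeds \<open>y powr R\<close> has a prime factor \<open>\<ge> y\<close>. Two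
  disjoint progressions with squarefree moduli differ modulo a common prime factor, so a tree that
  repeatedly picks a pivot modulus and branches over its at most \<open>R\<close> primes and over the residue
  classes modulo these primes shows that there are at most \<open>(R + 1) powr R * x / y\<close> moduli of this
  kind, and \<open>(R + 1) powr R = L(1/2 + o(1), x)\<close>.
\<close>

section \<open>Squarefree divisibility and disjoint progressions\<close>

lemma squarefree_dvd:
  fixes m n :: "'a :: factorial_semiring"
  assumes "squarefree m" and "\<And>p. prime p \<Longrightarrow> p dvd m \<Longrightarrow> p dvd n"
  shows "m dvd n"
proof (cases "n = 0")
  case False
  have m: "m \<noteq> 0"
    using assms(1) by auto
  have "multiplicity p m \<le> multiplicity p n" if p: "prime p" for p
  proof (cases "p dvd m")
    case True
    have "multiplicity p m \<le> 1"
      using assms(1) m p squarefree_factorial_semiring'' by blast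
    moreover have "multiplicity p n \<ge> 1"
      using assms(2)[OF p True] False p by (simp add: Suc_le_eq prime_multiplicity_gt_zero_iff)
    ultimately show ?thesis by linarith
  qed (simp add: not_dvd_imp_multiplicity_0)
  then show ?thesis
    using m False prime_multiplicity_le_imp_dvd by blast
qed auto

text \<open>Otherwise every prime of \<open>gcd m n\<close> divides \<open>b - a\<close>. The gcd
  inherits squarefreeness from \<open>m\<close>, so it divides \<open>b - a\<close> itself, and
  Bezout's identity yields an integer in both progressions.\<close>

lemma disjoint_arith_prog_prime:
  assumes "squarefree m" "arith_prog a m \<inter> arith_prog b n = {}"
  obtains p where "prime p" "p dvd m" "p dvd n" "\<not> [a = b] (mod p)"
proof -
  have "\<exists>p. prime p \<and> p dvd m \<and> p dvd n \<and> \<not> [a = b] (mod p)"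
  proof (rule ccontr)
    assume "\<not> ?thesis"
    then have *: "p dvd b - a" if "prime p" "p dvd gcd m n" for p
      using that by (auto simp: cong_iff_dvd_diff dvd_diff_commute)
    have "gcd m n dvd b - a"
      using squarefree_mono[OF gcd_dvd1 assms(1)] * by (rule squarefree_dvd)
    then obtain t where t: "b - a = gcd m n * t" ..
    obtain u v where uv: "u * m + v * n = gcd m n"
      using bezout_int by blast
    have "b - a = u * m * t + v * n * t"
      by (simp add: t flip: uv) (simp add: distrib_right)
    then have "b - v * n * t = a + u * m * t" by linarith
    moreover have "[a + u * m * t = a] (mod m)" "[b - v * n * t = b] (mod n)"
      by (auto simp: cong_iff_dvd_diff)
    ultimately have "a + u * m * t \<in> arith_prog a m \<inter> arith_prog b n"
      by (simp add: arith_prog_def)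
    with assms(2) show False by blast
  qed
  with that show thesis by blast
qed

section \<open>Squarefree integers with many prime factors\<close>

text \<open>
  \<open>m ^ \<omega>(n)\<close> is the number of factorizations of a squarefree \<open>n\<close> into \<open>m\<close> factors; weighting with it
  bounds the integers with many prime factors without any estimate for sums over primes.
\<close>

lemma power_card_prime_factors_le:
  fixes n m :: nat
  assumes "n > 0"
  shows "real (Suc m) ^ card (prime_factors n)
    \<le> (\<Sum>d | d dvd n \<and> squarefree d. real m ^ card (prime_factors d))"
proof -
  let ?S = "prime_factors n"
  have pf: "prime_factors (\<Prod>A) = A" if "A \<subseteq> ?S" for A
  proof -
    have "finite A" using that by (rule finite_subset) simp
    moreover have "0 \<notin> A" using that by (auto simp: prime_factors_dvd)
    moreover have "prime_factors p = {p}" if "p \<in> A" for p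
      using \<open>A \<subseteq> ?S\<close> that by (intro prime_prime_factors) auto
    ultimately show ?thesis
      by (subst prime_factors_prod) auto
  qed
  have dv: "\<Prod>A dvd n \<and> squarefree (\<Prod>A)" if "A \<subseteq> ?S" for A
  proof -
    have "squarefree (\<Prod>A)"
    proof (rule squarefree_prod_coprime)
      have pr: "prime p" if "p \<in> A" for p
        using \<open>A \<subseteq> ?S\<close> that by auto
      show "coprime p r" if "p \<in> A" "r \<in> A" "p \<noteq> r" for p r
        using pr that by (simp add: primes_coprime)
      show "squarefree p" if "p \<in> A" for p
        using pr that by (simp add: squarefree_prime)
    qed
    moreover have "p dvd n" if "prime p" "p dvd \<Prod>A" for p
    proof -
      have "p \<in> prime_factors (\<Prod>A)"
        using that calculation by (auto simp: in_prime_factors_iff intro: gr0I)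
      then show ?thesis
        using pf[OF \<open>A \<subseteq> ?S\<close>] \<open>A \<subseteq> ?S\<close> by (simp add: subset_iff in_prime_factors_iff)
    qed
    ultimately show ?thesis
      using squarefree_dvd by blast
  qed
  \<comment> \<open>A set of primes is recovered from its product by \<open>pf\<close>, so the
    subset expansion below runs over distinct divisors.\<close>
  have inj: "inj_on Prod (Pow ?S)"
    by (rule inj_onI) (metis PowD pf)
  have "real (Suc m) ^ card ?S = (\<Prod>p\<in>?S. real m + 1)"
    by (simp add: add.commute)
  also have "\<dots> = (\<Sum>A\<in>Pow ?S. real m ^ card A)"
    by (subst prod_add) auto
  also have "\<dots> = (\<Sum>A\<in>Pow ?S. real m ^ card (prime_factors (\<Prod>A)))"
    using pf by (intro sum.cong) auto
  also have "\<dots> = (\<Sum>d\<in>Prod ` Pow ?S. real m ^ card (prime_factors d))"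
    using inj by (subst sum.reindex) auto
  also have "\<dots> \<le> (\<Sum>d | d dvd n \<and> squarefree d. real m ^ card (prime_factors d))"
    using dv assms by (intro sum_mono2) auto
  finally show ?thesis .
qed

text \<open>Induction on \<open>m\<close>: one more factor splits \<open>n\<close> as
  \<open>d * e\<close>, and letting \<open>e\<close> range freely over \<open>{1..N}\<close> makes
  the double sum a product, at the cost of one more harmonic number.\<close>

lemma sum_power_card_prime_factors_le:
  fixes N m :: nat
  shows "(\<Sum>n\<in>{n \<in> {1..N}. squarefree n}. real m ^ card (prime_factors n) / real n) \<le> harm N ^ m"
proof (induction m)
  case 0
  \<comment> \<open>Since \<open>0 ^ 0 = 1\<close>, the weight for \<open>m = 0\<close> keeps only
    the term \<open>n = 1\<close>.\<close>
  have "(\<Sum>n\<in>{n \<in> {1..N}. squarefree n}. real 0 ^ card (prime_factors n) / real n)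
      \<le> (\<Sum>n\<in>{n \<in> {1..N}. squarefree n}. if n = 1 then 1 else 0)"
    by (intro sum_mono) (auto simp: power_0_left prime_factorization_empty_iff)
  also have "\<dots> \<le> 1"
    by (subst sum.delta) auto
  finally show ?case by simp
next
  case (Suc m)
  let ?S = "{n \<in> {1..N}. squarefree n}"
  let ?g = "\<lambda>d::nat. real m ^ card (prime_factors d)"
  have "(\<Sum>n\<in>?S. real (Suc m) ^ card (prime_factors n) / real n)
      \<le> (\<Sum>n\<in>?S. (\<Sum>d | d dvd n \<and> squarefree d. ?g d) / real n)"
    by (intro sum_mono divide_right_mono power_card_prime_factors_le) auto
  also have "\<dots> = (\<Sum>(n, d)\<in>(SIGMA n:?S. {d. d dvd n \<and> squarefree d}). ?g d / real n)"
    by (simp add: sum_divide_distrib sum.Sigma)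
  \<comment> \<open>Each pair \<open>(n, d)\<close> comes from \<open>(d, n div d)\<close>; the
    pairs on the right whose product is too large or not squarefree only add nonnegative
    terms.\<close>
  also have "\<dots> \<le> (\<Sum>(d, e)\<in>?S \<times> {1..N}. (?g d / real d) * (1 / real e))"
  proof (rule sum_le_included[where i = "\<lambda>(d, e). (d * e, d)"])
    show "\<forall>x\<in>SIGMA n:?S. {d. d dvd n \<and> squarefree d}. \<exists>y\<in>?S \<times> {1..N}.
        (case y of (d, e) \<Rightarrow> (d * e, d)) = x \<and>
        (case x of (n, d) \<Rightarrow> ?g d / real n) \<le> (case y of (d, e) \<Rightarrow> (?g d / real d) * (1 / real e))"
    proof clarify
      fix n d :: nat assume *: "n \<in> {1..N}" "squarefree d" "d dvd n"
      then obtain e where e: "n = d * e" by blast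
      have "d \<le> n" "e \<le> n"
        using * e by (auto intro: dvd_imp_le)
      moreover have "d > 0" "e > 0"
        using * e by auto
      ultimately have "d \<in> ?S" "e \<in> {1..N}"
        using *(1,2) by (simp_all add: Suc_le_eq)
      then show "\<exists>y\<in>?S \<times> {1..N}. (case y of (d, e) \<Rightarrow> (d * e, d)) = (n, d) \<and>
          ?g d / real n \<le> (case y of (d, e) \<Rightarrow> (?g d / real d) * (1 / real e))"
        using e by (intro bexI[of _ "(d, e)"]) auto
    qed
  qed auto
  also have "\<dots> = (\<Sum>d\<in>?S. ?g d / real d) * harm N"
    by (simp add: sum_product sum.cartesian_product harm_def inverse_eq_divide)
  also have "\<dots> \<le> harm N ^ m * harm N"
    using Suc.IH by (intro mult_right_mono) (auto simp: harm_nonneg)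
  finally show ?case by (simp add: mult.commute)
qed

text \<open>Rankin's trick: each counted \<open>n\<close> has
  \<open>m ^ K / N <= m ^ card (prime_factors n) / n\<close>, so the weighted sum controls the
  count.\<close>

lemma card_many_prime_factors_le:
  fixes N m K :: nat
  assumes "m > 0"
  shows "real (card {n \<in> {1..N}. squarefree n \<and> K \<le> card (prime_factors n)})
    \<le> real N * harm N ^ m / real m ^ K"
proof -
  let ?A = "{n \<in> {1..N}. squarefree n \<and> K \<le> card (prime_factors n)}"
  have "real (card ?A) * (real m ^ K / real N) = (\<Sum>n\<in>?A. real m ^ K / real N)"
    by simp
  also have "\<dots> \<le> (\<Sum>n\<in>?A. real m ^ card (prime_factors n) / real n)"
    using assms by (intro sum_mono frac_le power_increasing) auto
  also have "\<dots> \<le> (\<Sum>n\<in>{n \<in> {1..N}. squarefree n}. real m ^ card (prime_factors n) / real n)"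
    by (intro sum_mono2) auto
  also have "\<dots> \<le> harm N ^ m"
    by (rule sum_power_card_prime_factors_le)
  finally show ?thesis
    using assms by (cases "N = 0") (auto simp: field_simps)
qed

section \<open>Disjoint progressions whose moduli have a large prime factor\<close>

lemma card_divisible_le:
  fixes q :: "'i \<Rightarrow> nat"
  assumes "inj_on q I" "d > 0" "x \<ge> 0" "\<And>i. i \<in> I \<Longrightarrow> d dvd q i \<and> 0 < q i \<and> real (q i) \<le> x"
  shows "real (card I) \<le> x / d"
proof -
  let ?f = "\<lambda>i. q i div d"
  have "inj_on ?f I"
    using assms by (intro inj_onI) (metis dvd_mult_div_cancel inj_onD)
  moreover have "?f ` I \<subseteq> {1..nat \<lfloor>x / d\<rfloor>}"
  proof clarify
    fix i assume i: "i \<in> I"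
    then obtain e where e: "q i = d * e" using assms(4) by blast
    have "real d * e \<le> x" using assms(4)[OF i] e by simp
    then have "real e \<le> x / d" using assms(2) by (simp add: field_simps)
    then show "?f i \<in> {1..nat \<lfloor>x / d\<rfloor>}"
      using assms(2) assms(4)[OF i] e by (auto simp: le_nat_floor Suc_le_eq)
  qed
  ultimately have "card I \<le> nat \<lfloor>x / d\<rfloor>"
    by (metis card_atLeastAtMost card_inj_on_le diff_Suc_1 finite_atLeastAtMost)
  then show ?thesis
    using assms(3) by (simp add: le_nat_iff le_floor_iff)
qed

text \<open>
  The members of \<open>I\<close> lie in one class modulo \<open>P\<close>, so every other member meets a fixed pivot in a
  prime \<open>p\<close> outside \<open>P\<close>. If \<open>p \<ge> y\<close>, counting the multiples of \<open>P * p\<close> suffices; otherwise split into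
  the \<open>p\<close> classes modulo \<open>p\<close> and recurse with \<open>P * p\<close>, whose extra factor \<open>p\<close> pays for the splitting.
\<close>

lemma card_disjoint_progressions_le:
  fixes q :: "'i \<Rightarrow> nat" and a :: "'i \<Rightarrow> int" and x y :: real
  assumes "finite I" "inj_on q I" "y > 0" "x \<ge> 0"
    and "\<And>i. i \<in> I \<Longrightarrow> squarefree (q i) \<and> real (q i) \<le> x"
    and "\<And>i. i \<in> I \<Longrightarrow> \<exists>p. prime p \<and> p dvd q i \<and> y \<le> real p"
    and "\<And>i j. i \<in> I \<Longrightarrow> j \<in> I \<Longrightarrow> i \<noteq> j \<Longrightarrow>
      \<exists>p. prime p \<and> p dvd q i \<and> p dvd q j \<and> \<not> [a i = a j] (mod int p)"
    and "\<And>i. i \<in> I \<Longrightarrow> card (prime_factors (q i)) \<le> card (prime_factors P) + n"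
    and "P > 0" "\<And>p. prime p \<Longrightarrow> p dvd P \<Longrightarrow> real p < y"
    and "\<And>i. i \<in> I \<Longrightarrow> P dvd q i"
    and "\<And>i j. i \<in> I \<Longrightarrow> j \<in> I \<Longrightarrow> [a i = a j] (mod int P)"
  shows "real (card I) \<le> real (n + 1) ^ n * (x / (P * y))"
  using assms
proof (induction n arbitrary: I P)
  case 0
  \<comment> \<open>With no primes left, every prime of \<open>q i\<close> divides \<open>P\<close>
    and is below \<open>y\<close>, against the large prime factor of \<open>q i\<close>.\<close>
  have "I = {}"
  proof (rule ccontr)
    assume "I \<noteq> {}"
    then obtain i where i: "i \<in> I" by blast
    have q0: "q i \<noteq> 0" using "0.prems"(5)[OF i] by (auto intro: gr0I)
    have sub: "prime_factors P \<subseteq> prime_factors (q i)"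
      using "0.prems"(11)[OF i] q0 by (rule dvd_prime_factors[rotated])
    have "prime_factors P = prime_factors (q i)"
      using "0.prems"(8)[OF i] by (intro card_seteq sub) auto
    moreover obtain p where "prime p" "p dvd q i" "y \<le> real p"
      using "0.prems"(6)[OF i] by blast
    ultimately show False
      using q0 "0.prems"(10) by (metis in_prime_factors_iff not_le)
  qed
  then show ?case using "0.prems"(3,4) by simp
next
  case (Suc n)
  define B where "B = x / (P * y)"
  show ?case
  proof (cases "I = {}")
    case True
    then show ?thesis using Suc.prems(3,4) by simp
  next
    case False
    then obtain i where i: "i \<in> I" by blast
    have q0: "q j \<noteq> 0" if "j \<in> I" for j using Suc.prems(5)[OF that] by (auto intro: gr0I)
    have cop: "coprime P p" if "prime p" "\<not> p dvd P" for p
      using prime_imp_coprime[OF that] by (simp add: coprime_commute)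
    \<comment> \<open>The large prime \<open>p\<close> of the pivot cannot divide \<open>P\<close>,
      so \<open>P * y <= P * p <= q i <= x\<close>. This later lets \<open>B\<close> absorb the
      pivot itself.\<close>
    have B1: "B \<ge> 1"
    proof -
      obtain p where p: "prime p" "p dvd q i" "y \<le> real p"
        using Suc.prems(6)[OF i] by blast
      then have "\<not> p dvd P" using Suc.prems(10)[of p] by auto
      then have "P * p dvd q i"
        using p Suc.prems(11)[OF i] cop by (intro divides_mult) auto
      then have "P * p \<le> q i" using q0[OF i] by (intro dvd_imp_le) auto
      then have "real P * real p \<le> x"
        using Suc.prems(5)[OF i] by (metis of_nat_le_iff of_nat_mult order_trans)
      moreover have "real P * y \<le> real P * real p" using p by (intro mult_left_mono) auto
      ultimately have "real P * y \<le> x" by linarith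
      then show ?thesis
        unfolding B_def using Suc.prems(3,9) by (simp add: pos_le_divide_eq)
    qed
    define T where "T = prime_factors (q i) - prime_factors P"
    define G where "G p = {j \<in> I. p dvd q j}" for p
    have "prime_factors P \<subseteq> prime_factors (q i)"
      using Suc.prems(11)[OF i] q0[OF i] by (intro dvd_prime_factors)
    then have T: "finite T" "card T \<le> Suc n"
      using Suc.prems(8)[OF i] by (auto simp: T_def card_Diff_subset)
    have cover: "I \<subseteq> insert i (\<Union>p\<in>T. G p)"
    proof
      fix j assume j: "j \<in> I"
      show "j \<in> insert i (\<Union>p\<in>T. G p)"
      proof (cases "j = i")
        case False
        obtain p where p: "prime p" "p dvd q i" "p dvd q j" "\<not> [a i = a j] (mod int p)"
          using Suc.prems(7)[OF i j] False by blast
        \<comment> \<open>All members agree modulo \<open>P\<close>, so a prime separating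
          \<open>i\<close> from \<open>j\<close> cannot divide \<open>P\<close>.\<close>
        have "\<not> p dvd P"
          using Suc.prems(12)[OF i j] p(4) by (meson cong_dvd_modulus int_dvd_int_iff)
        then have "p \<in> T"
          using p q0[OF i] by (auto simp: T_def in_prime_factors_iff)
        then show ?thesis using p j by (auto simp: G_def)
      qed simp
    qed
    have G: "real (card (G p)) \<le> real (Suc n) ^ n * B" if "p \<in> T" for p
    proof -
      have p: "prime p" "p dvd q i" "\<not> p dvd P"
        using that Suc.prems(9) by (auto simp: T_def in_prime_factors_iff)
      then have p0: "p > 0" by (simp add: prime_gt_0_nat)
      have Gsub: "G p \<subseteq> I" by (auto simp: G_def)
      have Pp: "P * p dvd q j" if "j \<in> G p" for j
        using that p Suc.prems(11)[of j] cop by (intro divides_mult) (auto simp: G_def)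
      show ?thesis
      proof (cases "y \<le> real p")
        case True
        have "real (card (G p)) \<le> x / real (P * p)"
          using Suc.prems(2,4,5,9) p0 Pp q0 Gsub
          by (intro card_divisible_le[of q]) (auto intro: inj_on_subset)
        also have "\<dots> \<le> B"
          unfolding B_def using True Suc.prems(3,4,9) p0
          by (simp add: frac_le)
        also have "\<dots> \<le> real (Suc n) ^ n * B"
          using B1 by (simp add: mult_le_cancel_right1)
        finally show ?thesis .
      next
        case False
        define H where "H c = {j \<in> G p. a j mod int p = c}" for c
        have H: "real (card (H c)) \<le> real (n + 1) ^ n * (x / ((P * p) * y))" for c
        proof (rule Suc.IH)
          have Hsub: "H c \<subseteq> G p" by (auto simp: H_def)
          then have HI: "H c \<subseteq> I" using Gsub by blast
          show "finite (H c)" using HI Suc.prems(1) finite_subset by blast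
          show "inj_on q (H c)" using HI Suc.prems(2) inj_on_subset by blast
          \<comment> \<open>The prime \<open>p\<close> is new in \<open>P * p\<close>, so the budget
            of further primes drops from \<open>Suc n\<close> to \<open>n\<close>.\<close>
          show "card (prime_factors (q j)) \<le> card (prime_factors (P * p)) + n" if "j \<in> H c" for j
          proof -
            have "prime_factors (P * p) = insert p (prime_factors P)"
              using p Suc.prems(9) p0
              by (auto simp: prime_factors_product prime_prime_factors)
            then have "card (prime_factors (P * p)) = Suc (card (prime_factors P))"
              using p(3) by (simp add: in_prime_factors_iff)
            then show ?thesis using Suc.prems(8)[of j] that HI by auto
          qed
          show "P * p > 0" using Suc.prems(9) p0 by simp
          show "real r < y" if "prime r" "r dvd P * p" for r
            using that False Suc.prems(10) p(1)
            by (metis not_le prime_dvd_mult_iff primes_dvd_imp_eq)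
          show "P * p dvd q j" if "j \<in> H c" for j using that Hsub Pp by blast
          show "[a j = a k] (mod int (P * p))" if "j \<in> H c" "k \<in> H c" for j k
          proof -
            have "[a j = a k] (mod int p)" using that by (simp add: H_def unique_euclidean_semiring_class.cong_def)
            moreover have "[a j = a k] (mod int P)" using that HI Suc.prems(12) by blast
            ultimately show ?thesis
              using cop[OF p(1,3)] by (simp add: coprime_cong_mult)
          qed
          show "\<exists>r. prime r \<and> r dvd q j \<and> r dvd q k \<and> \<not> [a j = a k] (mod int r)"
            if "j \<in> H c" "k \<in> H c" "j \<noteq> k" for j k
            using that HI Suc.prems(7) by blast
        qed (use Suc.prems(3-6) Gsub in \<open>auto simp: H_def\<close>)
        have "G p \<subseteq> (\<Union>c\<in>{0..<int p}. H c)"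
          using p0 by (auto simp: H_def)
        moreover have "finite (G p)" using Gsub Suc.prems(1) finite_subset by blast
        ultimately have "card (G p) \<le> card (\<Union>c\<in>{0..<int p}. H c)"
          by (intro card_mono) (auto simp: H_def)
        also have "\<dots> \<le> (\<Sum>c\<in>{0..<int p}. card (H c))" by (intro card_UN_le) auto
        finally have "real (card (G p)) \<le> (\<Sum>c\<in>{0..<int p}. real (card (H c)))"
          by (metis of_nat_le_iff of_nat_sum)
        also have "\<dots> \<le> (\<Sum>c\<in>{0..<int p}. real (n + 1) ^ n * (x / ((P * p) * y)))"
          by (intro sum_mono H)
        also have "\<dots> = real (Suc n) ^ n * B"
          using p0 by (simp add: B_def)
        finally show ?thesis .
      qed
    qed
    have fin: "finite (\<Union>p\<in>T. G p)"
      using T Suc.prems(1) by (auto simp: G_def)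
    then have "card I \<le> card (insert i (\<Union>p\<in>T. G p))"
      by (intro card_mono cover) auto
    also have "\<dots> \<le> Suc (card (\<Union>p\<in>T. G p))"
      by (rule card_insert_le_m1[THEN order_trans]) (auto)
    also have "\<dots> \<le> Suc (\<Sum>p\<in>T. card (G p))"
      using T by (simp add: card_UN_le)
    finally have "real (card I) \<le> 1 + (\<Sum>p\<in>T. real (card (G p)))"
      by (metis of_nat_Suc of_nat_le_iff of_nat_sum)
    also have "\<dots> \<le> 1 + (\<Sum>p\<in>T. real (Suc n) ^ n * B)"
      using G by (intro add_left_mono sum_mono)
    also have "\<dots> \<le> B + real (Suc n) * (real (Suc n) ^ n * B)"
      using T B1 by (auto intro!: add_mono mult_right_mono)
    also have "\<dots> = (1 + real (Suc n) ^ Suc n) * B" by (simp add: algebra_simps)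
    \<comment> \<open>Raising the base from \<open>Suc n\<close> to \<open>Suc n + 1\<close> makes
      room for the pivot, the summand 1.\<close>
    also have "\<dots> \<le> real (Suc n + 1) ^ Suc n * B"
    proof (rule mult_right_mono)
      have "1 + Suc n ^ Suc n \<le> (Suc n + 1) ^ Suc n"
        using power_strict_mono[of "Suc n" "Suc n + 1" "Suc n"] by linarith
      from of_nat_mono[OF this, where 'a = real]
      show "1 + real (Suc n) ^ Suc n \<le> real (Suc n + 1) ^ Suc n"
        by (simp only: of_nat_add of_nat_1 of_nat_power)
    qed (use B1 in simp)
    finally show ?thesis unfolding B_def .
  qed
qed

section \<open>Splitting the moduli into three classes\<close>

lemma harm_le_ln:
  assumes "n > 0"
  shows "harm n \<le> 1 + ln (real n)"
  using euler_mascheroni_sequence_decreasing[of 1 n] assms by (simp add: harm_expand)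

text \<open>A squarefree \<open>n\<close> divides the product of its primes; at most
  \<open>K\<close> primes, all below \<open>y\<close>, would force
  \<open>n <= y ^ K\<close>.\<close>

lemma prime_factor_ge:
  fixes n :: nat
  assumes "squarefree n" "card (prime_factors n) \<le> K" "1 \<le> y" "y ^ K < real n"
  shows "\<exists>p. prime p \<and> p dvd n \<and> y \<le> real p"
proof (rule ccontr)
  assume neg: "\<not> ?thesis"
  have *: "real p < y" if "prime p" "p dvd n" for p
    using neg that not_le by blast
  let ?S = "prime_factors n"
  have "n dvd \<Prod>?S"
  proof (rule squarefree_dvd[OF assms(1)])
    fix p assume "prime p" "p dvd n"
    then show "p dvd \<Prod>?S"
      using assms(1) by (intro dvd_prodI[where f = "\<lambda>x. x"]) (auto simp: in_prime_factors_iff intro: gr0I)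
  qed
  then have "n \<le> \<Prod>?S"
    by (intro dvd_imp_le prod_pos) (auto simp: in_prime_factors_iff prime_gt_0_nat)
  then have "real n \<le> real (\<Prod>?S)"
    by (rule of_nat_mono)
  also have "\<dots> = (\<Prod>p\<in>?S. real p)"
    by (rule of_nat_prod)
  also have "\<dots> \<le> (\<Prod>p\<in>?S. y)"
    using * by (intro prod_mono) (auto intro: less_imp_le)
  also have "\<dots> \<le> y ^ K"
    using assms(2,3) by (simp add: power_increasing)
  finally show False using assms(4) by simp
qed

text \<open>The three terms bound the moduli up to \<open>y ^ K\<close>, those with more than
  \<open>K\<close> primes, and the rest, each of which has a prime factor at least \<open>y\<close>.
  The parameters stay free for later optimization.\<close>

lemma card_progressions_le:
  fixes q :: "'i \<Rightarrow> nat" and a :: "'i \<Rightarrow> int" and x y :: real and K m :: nat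
  assumes "finite I" "inj_on q I" "x \<ge> 1" "y \<ge> 1" "m > 0"
    and q: "\<And>i. i \<in> I \<Longrightarrow> squarefree (q i) \<and> real (q i) \<le> x"
    and disj: "\<And>i j. i \<in> I \<Longrightarrow> j \<in> I \<Longrightarrow> i \<noteq> j \<Longrightarrow>
      \<exists>p. prime p \<and> p dvd q i \<and> p dvd q j \<and> \<not> [a i = a j] (mod int p)"
  shows "real (card I) \<le> y ^ K + x * (1 + ln x) ^ m / real m ^ Suc K + real (K + 1) ^ K * (x / y)"
proof -
  have q0: "0 < q i" if "i \<in> I" for i
    using q[OF that] by (auto intro: gr0I)
  define I1 where "I1 = {i \<in> I. real (q i) \<le> y ^ K}"
  define I2 where "I2 = {i \<in> I. Suc K \<le> card (prime_factors (q i))}"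
  define I3 where "I3 = {i \<in> I. card (prime_factors (q i)) \<le> K \<and> y ^ K < real (q i)}"
  have "real (card I1) \<le> y ^ K / real 1"
    using assms(2,4) q0 by (intro card_divisible_le[of q]) (auto simp: I1_def intro: inj_on_subset)
  then have c1: "real (card I1) \<le> y ^ K" by simp
  define N where "N = nat \<lfloor>x\<rfloor>"
  have N: "N > 0" "real N \<le> x"
    using assms(3) by (auto simp: N_def)
  have c2: "real (card I2) \<le> x * (1 + ln x) ^ m / real m ^ Suc K"
  proof -
    have "card I2 \<le> card {n \<in> {1..N}. squarefree n \<and> Suc K \<le> card (prime_factors n)}"
    proof (rule card_inj_on_le[of q])
      show "inj_on q I2" using assms(2) by (auto simp: I2_def intro: inj_on_subset)
      show "q ` I2 \<subseteq> {n \<in> {1..N}. squarefree n \<and> Suc K \<le> card (prime_factors n)}"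
        using q q0 by (auto simp: I2_def N_def le_nat_floor Suc_le_eq)
    qed auto
    then have "real (card I2) \<le> real N * harm N ^ m / real m ^ Suc K"
      using card_many_prime_factors_le[OF assms(5), of N "Suc K"] by linarith
    also have "\<dots> \<le> x * (1 + ln x) ^ m / real m ^ Suc K"
    proof (intro divide_right_mono mult_mono power_mono)
      show "harm N \<le> 1 + ln x"
        using harm_le_ln[OF N(1)] N by (smt (verit) ln_le_cancel_iff of_nat_0_less_iff)
    qed (use N assms(3) in \<open>auto simp: harm_nonneg\<close>)
    finally show ?thesis .
  qed
  \<comment> \<open>The tree starts at \<open>P = 1\<close>, where the congruence condition is void
    and all \<open>K\<close> primes are still available.\<close>
  have c3: "real (card I3) \<le> real (K + 1) ^ K * (x / (real 1 * y))"
  proof (rule card_disjoint_progressions_le)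
    show "finite I3" "inj_on q I3"
      using assms(1,2) by (auto simp: I3_def intro: inj_on_subset)
    show "\<exists>p. prime p \<and> p dvd q i \<and> y \<le> real p" if "i \<in> I3" for i
      using that q assms(4) by (intro prime_factor_ge) (auto simp: I3_def)
    show "\<exists>p. prime p \<and> p dvd q i \<and> p dvd q j \<and> \<not> [a i = a j] (mod int p)"
      if "i \<in> I3" "j \<in> I3" "i \<noteq> j" for i j
      using that disj by (auto simp: I3_def)
  qed (use assms(3,4) q in \<open>auto simp: I3_def\<close>)
  have "I \<subseteq> I1 \<union> I2 \<union> I3"
    by (auto simp: I1_def I2_def I3_def)
  then have "card I \<le> card (I1 \<union> I2 \<union> I3)"
    using assms(1) by (intro card_mono) (auto simp: I1_def I2_def I3_def)
  also have "\<dots> \<le> card I1 + card I2 + card I3"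
    by (meson add_mono card_Un_le order_refl order_trans)
  finally show ?thesis using c1 c2 c3 by simp
qed

section \<open>Asymptotics and choice of parameters\<close>

text \<open>With \<open>l = ln x\<close>, the summands bound the three terms of
  \<open>card_progressions_le\<close> divided by \<open>x\<close>, for the parameters chosen in
  \<open>eventually_bound_less\<close>. Each exponent is
  \<open>-(1/2 + o(1)) * sqrt (l * ln l)\<close>, so any \<delta> > 0 suffices.\<close>

lemma eventually_exp_sum_less:
  fixes \<delta> :: real assumes "\<delta> > 0"
  shows "eventually (\<lambda>l. exp (- (sqrt (l * ln l) / 2))
      + exp ((sqrt (l / ln l) / ln l + 1) * ln (1 + l) - sqrt (l / ln l) * ln (sqrt (l / ln l) / ln l))
      + exp (sqrt (l / ln l) * ln (sqrt (l / ln l) + 1) - (sqrt (l * ln l) - ln l / 2))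
      < exp (- ((1 / 2 - \<delta>) * sqrt (l * ln l)))) at_top"
proof -
  \<comment> \<open>The gap between the exponents tends to infinity, so each summand drops below a
    third of the target.\<close>
  have aux: "eventually (\<lambda>l. exp (f l) < exp (- g l) / 3) at_top"
    if "filterlim (\<lambda>l. g l + f l) at_bot at_top" for f g :: "real \<Rightarrow> real"
  proof -
    have "eventually (\<lambda>l. g l + f l < - ln 3) at_top"
      using that by (auto simp: filterlim_at_bot_dense)
    then show ?thesis
    proof eventually_elim
      case (elim l)
      then have "exp (f l) < exp (- g l - ln 3)" by simp
      then show ?case by (simp add: exp_diff)
    qed
  qed
  have "filterlim (\<lambda>l::real. (1/2 - \<delta>) * sqrt (l * ln l) + - (sqrt (l * ln l) / 2)) at_bot at_top"
    using assms by real_asymp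
  note 1 = aux[OF this]
  have "filterlim (\<lambda>l::real. (1/2 - \<delta>) * sqrt (l * ln l) + ((sqrt (l / ln l) / ln l + 1) * ln (1 + l)
      - sqrt (l / ln l) * ln (sqrt (l / ln l) / ln l))) at_bot at_top"
    using assms by real_asymp
  note 2 = aux[OF this]
  have "filterlim (\<lambda>l::real. (1/2 - \<delta>) * sqrt (l * ln l) + (sqrt (l / ln l) * ln (sqrt (l / ln l) + 1)
      - (sqrt (l * ln l) - ln l / 2))) at_bot at_top"
    using assms by real_asymp
  note 3 = aux[OF this]
  show ?thesis
    using 1 2 3 by eventually_elim linarith
qed

lemma eventually_bound_less:
  fixes \<delta> :: real assumes "\<delta> > 0"
  shows "eventually (\<lambda>x. \<exists>y K m. y \<ge> 1 \<and> m > 0 \<and>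
    y ^ K + x * (1 + ln x) ^ m / real m ^ Suc K + real (K + 1) ^ K * (x / y) < x / L (1 / 2 - \<delta>) x) at_top"
proof -
  have *: "eventually (\<lambda>l::real. l \<ge> 1 \<and> ln l \<ge> 1 \<and> sqrt (l / ln l) / ln l \<ge> 1
      \<and> sqrt (l * ln l) - ln l / 2 \<ge> 0) at_top"
    by (intro eventually_conj; real_asymp)
  have "eventually (\<lambda>x::real. x > 0) at_top" by (rule eventually_gt_at_top)
  with eventually_compose_filterlim[OF eventually_conj[OF * eventually_exp_sum_less[OF assms]] ln_at_top]
  show ?thesis
  proof eventually_elim
    case (elim x)
    define l where "l = ln x"
    define s where "s = sqrt (l * ln l)"
    define R where "R = sqrt (l / ln l)"
    \<comment> \<open>As \<open>R * s = l\<close> and \<open>R * ln l = s\<close>, the correction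
      \<open>ln l / 2\<close> makes \<open>y powr R\<close> equal to
      \<open>x * exp (- s / 2)\<close> and costs \<open>y\<close> only a factor
      \<open>sqrt l\<close>.\<close>
    define y where "y = exp (s - ln l / 2)"
    define K where "K = nat \<lfloor>R\<rfloor>"
    \<comment> \<open>This keeps \<open>(1 + l) ^ m\<close> at \<open>exp (O(R))\<close> with
      \<open>R = o(s)\<close>, while \<open>ln m\<close> is still asymptotic to
      \<open>ln l / 2\<close>, so \<open>m ^ Suc K\<close> reaches
      \<open>exp ((1/2 + o(1)) * s)\<close>.\<close>
    define m where "m = nat \<lceil>R / ln l\<rceil>"
    have l: "l \<ge> 1" "ln l \<ge> 1" "R / ln l \<ge> 1" "s - ln l / 2 \<ge> 0"
      using elim by (simp_all add: l_def s_def R_def)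
    have less: "exp (- (s / 2)) + exp ((R / ln l + 1) * ln (1 + l) - R * ln (R / ln l))
        + exp (R * ln (R + 1) - (s - ln l / 2)) < exp (- ((1 / 2 - \<delta>) * s))"
      using elim by (simp add: l_def s_def R_def)
    have x: "x = exp l" using elim by (simp add: l_def)
    have R0: "R > 0" unfolding R_def using l(1,2) by (intro real_sqrt_gt_zero divide_pos_pos) linarith+
    have Rs: "R * s = l" "R * ln l = s"
    proof -
      define u v where "u = sqrt l" and "v = sqrt (ln l)"
      have "R = u / v" "s = u * v"
        by (simp_all add: R_def s_def u_def v_def real_sqrt_mult real_sqrt_divide)
      moreover have "ln l > 0" "l > 0"
        using l(1,2) by linarith+
      then have "l = u * u" "ln l = v * v" "v \<noteq> 0"
        unfolding u_def v_def by (simp_all only: real_sqrt_mult_self abs_of_pos real_sqrt_eq_zero_cancel_iff)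
      ultimately show "R * s = l" "R * ln l = s" by simp_all
    qed
    \<comment> \<open>\<open>K <= R\<close> serves \<open>y ^ K\<close> and
      \<open>(K + 1) ^ K\<close>; \<open>R <= Suc K\<close> serves the denominator
      \<open>m ^ Suc K\<close>.\<close>
    have K: "real K \<le> R" "R \<le> real (Suc K)"
      using R0 unfolding K_def by linarith+
    have m: "R / ln l \<le> real m" "real m \<le> R / ln l + 1"
      using l(3) unfolding m_def by linarith+
    have m0: "m > 0" using m l by (auto intro: gr0I)
    have y1: "y \<ge> 1" using l by (simp add: y_def)
    have t1: "y ^ K \<le> x * exp (- (s / 2))"
    proof -
      have "y ^ K = exp (real K * (s - ln l / 2))"
        by (simp add: y_def exp_of_nat_mult)
      also have "\<dots> \<le> exp (R * (s - ln l / 2))"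
        using K l by (simp add: mult_right_mono)
      also have "R * (s - ln l / 2) = l - s / 2"
        using Rs by (simp add: algebra_simps)
      finally show ?thesis by (simp add: x flip: exp_add)
    qed
    have t2: "(1 + ln x) ^ m / real m ^ Suc K \<le> exp ((R / ln l + 1) * ln (1 + l) - R * ln (R / ln l))"
    proof -
      have "(1 + ln x) ^ m = exp (real m * ln (1 + l))"
        using l by (simp add: exp_of_nat_mult l_def)
      also have "\<dots> \<le> exp ((R / ln l + 1) * ln (1 + l))"
        using m l by (simp add: mult_right_mono)
      finally have A: "(1 + ln x) ^ m \<le> exp ((R / ln l + 1) * ln (1 + l))" .
      have "exp (R * ln (R / ln l)) \<le> exp (real (Suc K) * ln (real m))"
        using K m l R0 m0 by (intro iffD2[OF exp_le_cancel_iff] mult_mono) auto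
      also have "\<dots> = real m ^ Suc K"
        using m0 by (subst exp_of_nat_mult) simp
      finally show ?thesis
        unfolding exp_diff using A by (intro frac_le) auto
    qed
    have t3: "real (K + 1) ^ K * (x / y) \<le> x * exp (R * ln (R + 1) - (s - ln l / 2))"
    proof -
      have "real (K + 1) ^ K = exp (real K * ln (real (K + 1)))"
        by (subst exp_of_nat_mult) simp
      also have "\<dots> \<le> exp (R * ln (R + 1))"
        using K R0 by (intro iffD2[OF exp_le_cancel_iff] mult_mono) auto
      finally have "real (K + 1) ^ K * (x / y) \<le> exp (R * ln (R + 1)) * (x / y)"
        using elim by (intro mult_right_mono) (auto simp: y_def)
      then show ?thesis by (simp add: y_def exp_diff mult_ac)
    qed
    have "y ^ K + x * (1 + ln x) ^ m / real m ^ Suc K + real (K + 1) ^ K * (x / y)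
      \<le> x * exp (- (s / 2)) + x * exp ((R / ln l + 1) * ln (1 + l) - R * ln (R / ln l))
        + x * exp (R * ln (R + 1) - (s - ln l / 2))"
      using t1 mult_left_mono[OF t2, of x] t3 elim by simp
    also have "\<dots> < x * exp (- ((1 / 2 - \<delta>) * s))"
      using mult_strict_left_mono[OF less, of x] elim by (simp add: distrib_left)
    also have "\<dots> = x / L (1 / 2 - \<delta>) x"
      by (simp only: L_def l_def s_def exp_minus divide_inverse)
    finally show ?case using y1 m0 by (intro exI conjI)
  qed
qed

section \<open>A uniform o(1) and the theorem\<close>

text \<open>The sharp rate at \<open>x\<close> is the infimum of all admissible \<open>\<delta>\<close>; adding \<open>1 / x\<close> gives an admissible value.\<close>

lemma exists_uniform_rate:
  fixes P :: "real \<Rightarrow> real \<Rightarrow> bool"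
  assumes "\<And>\<delta>. \<delta> > 0 \<Longrightarrow> eventually (P \<delta>) at_top"
    and mono: "\<And>x \<delta> \<delta>'. x \<ge> x0 \<Longrightarrow> P \<delta> x \<Longrightarrow> \<delta> \<le> \<delta>' \<Longrightarrow> P \<delta>' x"
    and c: "c \<ge> 0" "\<And>x. x \<ge> x0 \<Longrightarrow> P c x" and "x0 > 0"
  shows "\<exists>\<epsilon>. (\<epsilon> \<longlongrightarrow> 0) at_top \<and> (\<forall>x\<ge>x0. P (\<epsilon> x) x)"
proof -
  \<comment> \<open>Requiring \<delta> \<ge> 0 bounds the infimum below; that \<open>e / 2\<close>
    eventually lies in \<open>D x\<close> bounds it above.\<close>
  define D where "D x = {\<delta>. \<delta> \<ge> 0 \<and> P \<delta> x}" for x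
  define \<epsilon> where "\<epsilon> x = Inf (D x) + 1 / x" for x
  have bdd: "bdd_below (D x)" for x by (auto simp: D_def)
  have "((\<lambda>x. Inf (D x)) \<longlongrightarrow> 0) at_top"
  proof (rule tendstoI)
    fix e :: real assume "e > 0"
    with assms(1)[of "e / 2"] have "eventually (P (e / 2)) at_top" by simp
    then show "eventually (\<lambda>x. dist (Inf (D x)) 0 < e) at_top"
    proof eventually_elim
      case (elim x)
      then have "e / 2 \<in> D x" using \<open>e > 0\<close> by (simp add: D_def)
      then have "Inf (D x) \<le> e / 2"
        by (intro cInf_lower bdd)
      moreover have "D x \<noteq> {}"
        using \<open>e / 2 \<in> D x\<close> by blast
      then have "Inf (D x) \<ge> 0"
        by (rule cInf_greatest) (simp add: D_def)
      ultimately show ?case using \<open>e > 0\<close> by simp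
    qed
  qed
  moreover have "((\<lambda>x::real. 1 / x) \<longlongrightarrow> 0) at_top" by real_asymp
  ultimately have "(\<epsilon> \<longlongrightarrow> 0) at_top"
    unfolding \<epsilon>_def using tendsto_add[of _ 0 at_top _ 0] by simp
  moreover have "P (\<epsilon> x) x" if "x \<ge> x0" for x
  proof -
    have "D x \<noteq> {}" using c that by (auto simp: D_def)
    moreover have "Inf (D x) < \<epsilon> x" using that \<open>x0 > 0\<close> by (simp add: \<epsilon>_def)
    ultimately obtain \<delta> where "\<delta> \<in> D x" "\<delta> < \<epsilon> x"
      using cInf_lessD by blast
    then show ?thesis using mono[OF that, of \<delta> "\<epsilon> x"] by (simp add: D_def)
  qed
  ultimately show ?thesis by blast
qed

lemma squarefree_nat:
  assumes "squarefree q" "q > 0" shows "squarefree (nat q)"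
proof (rule squarefreeI)
  fix y assume "y\<^sup>2 dvd nat q"
  then have "(int y)\<^sup>2 dvd q"
    using assms(2) by (metis int_dvd_int_iff of_nat_power int_nat_eq less_imp_le)
  then have "int y dvd 1" using assms(1) squarefreeD by blast
  then show "y dvd 1" by simp
qed

theorem theorem1:
  "\<exists>\<epsilon> :: real \<Rightarrow> real. (\<epsilon> \<longlongrightarrow> 0) at_top \<and>
     (\<forall>x \<ge> exp 1. \<forall>(k :: nat) (a :: nat \<Rightarrow> int) (q :: nat \<Rightarrow> int).
        strict_mono_on {1..k} q \<and>
        (\<forall>i \<in> {1..k}. squarefree (q i) \<and> 2 \<le> q i \<and> real_of_int (q i) \<le> x) \<and>
        disjoint_family_on (\<lambda>i. arith_prog (a i) (q i)) {1..k}
        \<longrightarrow> real k < x / L (1 / 2 - \<epsilon> x) x)"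
\<comment> \<open>At \<delta> = 1/2 the value of \<open>L\<close> is 1 and the claim is
  \<open>k < x\<close>, true for every \<open>x >= exp 1\<close>; this covers the \<open>x\<close>
  that the asymptotics do not reach.\<close>
proof (rule exists_uniform_rate[where c = "1 / 2"])
  let ?H = "\<lambda>x k a q. strict_mono_on {1..k::nat} q \<and>
        (\<forall>i \<in> {1..k}. squarefree (q i) \<and> (2::int) \<le> q i \<and> real_of_int (q i) \<le> x) \<and>
        disjoint_family_on (\<lambda>i. arith_prog (a i) (q i)) {1..k}"
  fix \<delta> :: real assume "\<delta> > 0"
  show "eventually (\<lambda>x. \<forall>k a q. ?H x k a q \<longrightarrow> real k < x / L (1 / 2 - \<delta>) x) at_top"
    using eventually_bound_less[OF \<open>\<delta> > 0\<close>] eventually_ge_at_top[of 1]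
  proof eventually_elim
    case (elim x)
    then obtain y K m where *: "y \<ge> 1" "m > 0" and
      less: "y ^ K + x * (1 + ln x) ^ m / real m ^ Suc K + real (K + 1) ^ K * (x / y) < x / L (1 / 2 - \<delta>) x"
      by blast
    show ?case
    proof (intro allI impI)
      fix k a q assume H: "?H x k a q"
      then have q: "squarefree (q i)" "q i > 0" "real_of_int (q i) \<le> x" if "i \<in> {1..k}" for i
        using that by force+
      have "real (card {1..k}) \<le>
        y ^ K + x * (1 + ln x) ^ m / real m ^ Suc K + real (K + 1) ^ K * (x / y)"
      proof (rule card_progressions_le[where q = "\<lambda>i. nat (q i)" and a = a])
        have "inj_on q {1..k}" using H strict_mono_on_imp_inj_on by blast
        then show "inj_on (\<lambda>i. nat (q i)) {1..k}"
          using q(2) by (intro inj_onI) (metis eq_nat_nat_iff inj_onD less_imp_le)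
        show "squarefree (nat (q i)) \<and> real (nat (q i)) \<le> x" if "i \<in> {1..k}" for i
          using q[OF that] squarefree_nat by simp
        show "\<exists>p. prime p \<and> p dvd nat (q i) \<and> p dvd nat (q j) \<and> \<not> [a i = a j] (mod int p)"
          if ij: "i \<in> {1..k}" "j \<in> {1..k}" "i \<noteq> j" for i j
        proof -
          have "arith_prog (a i) (q i) \<inter> arith_prog (a j) (q j) = {}"
            using H ij by (auto simp: disjoint_family_on_def)
          then obtain p where p: "prime p" "p dvd q i" "p dvd q j" "\<not> [a i = a j] (mod p)"
            using disjoint_arith_prog_prime q(1)[OF ij(1)] by metis
          then have "prime (nat p)" "int (nat p) = p"
            by (simp_all add: prime_ge_0_int)
          then show ?thesis using p q(2)[OF ij(1)] q(2)[OF ij(2)]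
            by (intro exI[of _ "nat p"]) (auto simp: nat_dvd_iff prime_ge_0_int)
        qed
      qed (use elim * in auto)
      with less show "real k < x / L (1 / 2 - \<delta>) x" by simp
    qed
  qed
next
  fix x \<delta> \<delta>' :: real
  assume x: "x \<ge> exp 1" and "\<delta> \<le> \<delta>'"
  \<comment> \<open>This makes the square root in \<open>L\<close> nonnegative, so a larger \<delta>
    only weakens the bound.\<close>
  have "ln x \<ge> 1" using x by (metis exp_gt_zero ln_exp ln_mono)
  then have "L (1 / 2 - \<delta>') x \<le> L (1 / 2 - \<delta>) x"
    using \<open>\<delta> \<le> \<delta>'\<close> by (auto simp: L_def intro!: mult_right_mono)
  moreover have "0 < x" using x by (meson exp_gt_zero less_le_trans)
  ultimately have "x / L (1 / 2 - \<delta>) x \<le> x / L (1 / 2 - \<delta>') x"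
    by (intro divide_left_mono) (auto simp: L_def)
  moreover assume "\<forall>k a q. strict_mono_on {1..k::nat} q \<and>
        (\<forall>i \<in> {1..k}. squarefree (q i) \<and> (2::int) \<le> q i \<and> real_of_int (q i) \<le> x) \<and>
        disjoint_family_on (\<lambda>i. arith_prog (a i) (q i)) {1..k}
        \<longrightarrow> real k < x / L (1 / 2 - \<delta>) x"
  ultimately show "\<forall>k a q. strict_mono_on {1..k::nat} q \<and>
        (\<forall>i \<in> {1..k}. squarefree (q i) \<and> (2::int) \<le> q i \<and> real_of_int (q i) \<le> x) \<and>
        disjoint_family_on (\<lambda>i. arith_prog (a i) (q i)) {1..k}
        \<longrightarrow> real k < x / L (1 / 2 - \<delta>') x"
    by (meson less_le_trans)
next
  fix x :: real assume "x \<ge> exp 1"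
  then have x: "0 < x" by (meson exp_gt_zero less_le_trans)
  show "\<forall>k a q. strict_mono_on {1..k::nat} q \<and>
        (\<forall>i \<in> {1..k}. squarefree (q i) \<and> (2::int) \<le> q i \<and> real_of_int (q i) \<le> x) \<and>
        disjoint_family_on (\<lambda>i. arith_prog (a i) (q i)) {1..k}
        \<longrightarrow> real k < x / L (1 / 2 - 1 / 2) x"
  proof clarify
    fix k :: nat and a q :: "nat \<Rightarrow> int"
    assume mono: "strict_mono_on {1..k} q"
      and q: "\<forall>i\<in>{1..k}. squarefree (q i) \<and> 2 \<le> q i \<and> real_of_int (q i) \<le> x"
    \<comment> \<open>Distinct moduli starting at 2 leave at most \<open>floor x - 1\<close>
      progressions, which gives the strict inequality.\<close>
    have "card {1..k} \<le> card {2..\<lfloor>x\<rfloor>}"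
      using mono q by (intro card_inj_on_le[of q])
        (auto simp: le_floor_iff dest: strict_mono_on_imp_inj_on)
    then have "k \<le> nat (\<lfloor>x\<rfloor> - 1)" by simp
    then have "real k < x" using x by linarith
    then show "real k < x / L (1 / 2 - 1 / 2) x" by (simp add: L_def)
  qed
qed auto

end
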